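(* Let $n\geq 3$ be an integer, let $F$ be an algebraically closed field with either $\mathrm{char}(F)>n$ or $\mathrm{char}(F)=0$, and let $S=F[y_1,\ldots,y_n]$. Let $V\subseteq (S_1)^n$ be a two-dimensional $F$-subspace such that the $S$-submodule $S.V$ of $S^n$ generated by $V$ is a free $S$-module of rank $2$. If $V$ has the $\vec{y}$-local membership property, then $\vec{y}\in V$.
   Context: $S=F[y_1,\ldots,y_n]$ is the polynomial ring in $n$ commuting variables, and $S_1=\mathrm{Span}_F(y_1,\ldots,y_n)\subseteq S$ is the space of homogeneous linear forms (including $0$). $\vec{y}=[y_1,\ldots,y_n]^T\in (S_1)^n\subseteq S^n$. For an $F$-subspace $V\subseteq (S_1)^n$, $S.V$ denotes the $S$-submodule of $S^n$ generated by $V$. For a maximal ideal $\mathfrak{m}\subseteq S$, $\phi_{\mathfrak{m}}:S^n\to (S/\mathfrak{m})^n$ is the map reducing each component modulo $\mathfrak{m}$. An $F$-subspace $V\subseteq (S_1)^n$ has the $\vec{y}$-local membership property if for every maximal ideal $\mathfrak{m}\subseteq S$ one has $\phi_{\mathfrak{m}}(\vec{y})\in \phi_{\mathfrak{m}}(S.V)$. *)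

theory Defs
  imports
    "HOL-Analysis.Cartesian_Space"
    "HOL-Computational_Algebra.Polynomial"
    "HOL-Library.Poly_Mapping"
    "HOL-Library.Set_Algebras"
begin

(* F[y_i | i :: 'n]: finitely supported maps from exponent vectors to coefficients, with the
   convolution product of Poly_Mapping.  The number of variables is CARD('n). *)
type_synonym ('n, 'a) mpoly = "('n \<Rightarrow>\<^sub>0 nat) \<Rightarrow>\<^sub>0 'a"

definition mconst :: "'a::zero \<Rightarrow> ('n, 'a) mpoly"
  where "mconst c = Poly_Mapping.single 0 c"

definition mvar :: "'n \<Rightarrow> ('n, 'a::zero_neq_one) mpoly"
  where "mvar i = Poly_Mapping.single (Poly_Mapping.single i 1) 1"

lemma mconst_add: "mconst (c + d) = mconst c + mconst d"
  by (simp add: mconst_def single_add)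

lemma mconst_mult: "mconst (c * d :: 'a::semiring_0) = mconst c * mconst d"
  by (simp add: mconst_def mult_single)

lemma mconst_1: "mconst (1 :: 'a::semiring_1) = 1"
  by (simp add: mconst_def)

global_interpretation F_poly:
  vector_space "\<lambda>(c::'a::field) (p::('n, 'a) mpoly). mconst c * p"
  by unfold_locales (simp_all add: mconst_add mconst_mult mconst_1 algebra_simps)

(* Otherwise this would be a simp rule reassociating ordinary products of polynomials. *)
lemmas [simp del] = F_poly.scale_scale

global_interpretation F_vec:
  vector_space "\<lambda>(c::'a::field) (v::('n, 'a) mpoly ^ 'm::finite). mconst c *s v"
  by unfold_locales
    (simp_all add: vec_eq_iff mconst_add mconst_mult mconst_1 algebra_simps)

global_interpretation R_vec: module "(*s) :: 'r::comm_ring_1 \<Rightarrow> 'r ^ 'm::finite \<Rightarrow> 'r ^ 'm"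
  by unfold_locales (simp_all add: vec_eq_iff algebra_simps)

definition linear_forms :: "('n, 'a::field) mpoly set"
  where "linear_forms = F_poly.span (range mvar)"

definition yvec :: "('n::finite, 'a::field) mpoly ^ 'n"
  where "yvec = (\<chi> i. mvar i)"

definition generated_submodule :: "('r::comm_ring_1 ^ 'm::finite) set \<Rightarrow> ('r ^ 'm) set"
  where "generated_submodule V = R_vec.span V"

definition free_of_rank :: "('r::comm_ring_1 ^ 'm::finite) set \<Rightarrow> nat \<Rightarrow> bool"
  where "free_of_rank M r \<longleftrightarrow>
    (\<exists>B. finite B \<and> card B = r \<and> R_vec.independent B \<and> R_vec.span B = M)"

definition is_ideal :: "'r::comm_ring_1 set \<Rightarrow> bool"
  where "is_ideal I \<longleftrightarrow> module.subspace (*) I"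

definition maximal_ideal :: "'r::comm_ring_1 set \<Rightarrow> bool"
  where "maximal_ideal I \<longleftrightarrow> is_ideal I \<and> I \<noteq> UNIV \<and>
    (\<forall>J. is_ideal J \<and> I \<subseteq> J \<longrightarrow> J = I \<or> J = UNIV)"

(* Elements of the quotient ring by I are represented as the cosets p +o I. *)
definition reduce_mod :: "'r::comm_ring_1 set \<Rightarrow> 'r ^ 'm::finite \<Rightarrow> 'r set ^ 'm"
  where "reduce_mod I v = (\<chi> i. (v $ i) +o I)"

definition y_local_membership :: "(('n::finite, 'a::field) mpoly ^ 'n) set \<Rightarrow> bool"
  where "y_local_membership V \<longleftrightarrow>
    (\<forall>\<mm>. maximal_ideal \<mm> \<longrightarrow>
      reduce_mod \<mm> yvec \<in> reduce_mod \<mm> ` generated_submodule V)"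

end

theory Submission
  imports Defs
begin

text \<open>
  Evaluating at a point \<open>a\<close> of affine space has a maximal ideal as its kernel, so local
  membership at these ideals says the following. If \<open>v\<close>, \<open>w\<close> is a basis of \<open>V\<close>
  and \<open>A\<close>, \<open>B\<close> are the linear operators \<open>a \<mapsto> v(a)\<close>, \<open>a \<mapsto> w(a)\<close> on \<open>F\<^sup>n\<close>, then every
  vector \<open>a\<close> lies in \<open>span(Aa, Ba)\<close>. It remains to show that one pair of scalars works for
  all \<open>a\<close> at once, that is, \<open>sA + tB = I\<close>; then \<open>sv + tw\<close> and the vector of variables have
  the same values everywhere, and linear forms are determined by their values. This is
  lemma \<open>identity_in_pencil\<close>, which is linear algebra in dimension at least \<open>3\<close>, away from
  characteristic \<open>2\<close>.

  If \<open>Aa\<close> and \<open>Ba\<close> are dependent for every \<open>a\<close>, then every vector is an eigenvector of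
  both operators, and an operator with this property that fixes a nonzero vector is the
  identity. Otherwise \<open>Aa\<^sub>0\<close>, \<open>Ba\<^sub>0\<close> are independent for some \<open>a\<^sub>0 = sAa\<^sub>0 + tBa\<^sub>0\<close>. The operator
  \<open>P = sA + tB\<close> fixes \<open>a\<^sub>0\<close>, and with a suitable \<open>Q \<in> {A, B}\<close> it spans the same pencil.
  Put \<open>b\<^sub>0 = Qa\<^sub>0\<close>, \<open>W = span(a\<^sub>0, b\<^sub>0)\<close> and \<open>C = P - I\<close>; the claim is \<open>C = 0\<close>, which is
  lemma \<open>generic_fixed_vector_imp_identity\<close>. For each \<open>a\<close> the three vectors \<open>a\<close>, \<open>Ca\<close>, \<open>Qa\<close>
  are dependent. Since \<open>Ca\<^sub>0 = 0\<close>, replacing \<open>a\<close> by \<open>a\<^sub>0 + za\<close> in \<open>a \<and> Ca \<and> Qa = 0\<close>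
  gives a polynomial in \<open>z\<close> whose lowest coefficient says \<open>Ca \<in> W\<close>, say
  \<open>Ca = f(a)a\<^sub>0 + g(a)b\<^sub>0\<close>, and whose next coefficient says \<open>f(a)a + g(a)Qa \<in> W\<close>.

  These relations force \<open>f\<close> to be a multiple \<open>\<kappa>g\<close>: if \<open>g(a) = 0 \<noteq> f(a)\<close>, then \<open>a \<in> W\<close>, and
  \<open>a \<and> a\<^sub>0 \<and> Qa = 0\<close> gives \<open>Qa \<in> W\<close>, so that polarizing the second relation puts every vector
  into \<open>W\<close>, against \<open>n \<ge> 3\<close>. If \<open>g \<noteq> 0\<close>, then with
  \<open>w = b\<^sub>0 + \<kappa>a\<^sub>0\<close> one has \<open>Ca = g(a)w\<close>, and the operator \<open>R = Q + \<kappa>P\<close> maps everything into \<open>W\<close>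
  and sends \<open>a\<^sub>0\<close> to \<open>w\<close>. For \<open>a \<notin> W\<close>, a relation \<open>a = s'Pa + t'Ra\<close> read modulo \<open>W\<close> gives
  \<open>s' = 1\<close>, hence \<open>g(a)w\<close> is a multiple of \<open>Ra\<close>. So if \<open>g(a) \<noteq> 0\<close> then \<open>Ra\<close> is a nonzero
  multiple of \<open>w\<close>, and subtracting a multiple of \<open>a\<^sub>0\<close> from \<open>a\<close> changes neither \<open>a \<notin> W\<close> nor
  \<open>g(a)\<close> but achieves \<open>Ra = 0\<close>, a contradiction. Hence \<open>g = f = 0\<close> and \<open>C = 0\<close>.
\<close>

section \<open>Three-by-three minors\<close>

text \<open>The coordinates of the trivector \<open>x \<and> y \<and> z\<close>.\<close>
definition wedge3 :: "'a::comm_ring_1 ^ 'n \<Rightarrow> 'a ^ 'n \<Rightarrow> 'a ^ 'n \<Rightarrow> 'n \<Rightarrow> 'n \<Rightarrow> 'n \<Rightarrow> 'a"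
  where "wedge3 x y z i j k =
    x $ i * (y $ j * z $ k - y $ k * z $ j) - x $ j * (y $ i * z $ k - y $ k * z $ i)
    + x $ k * (y $ i * z $ j - y $ j * z $ i)"

lemma wedge3_add:
  "wedge3 (x + x') y z i j k = wedge3 x y z i j k + wedge3 x' y z i j k"
  "wedge3 x (y + y') z i j k = wedge3 x y z i j k + wedge3 x y' z i j k"
  "wedge3 x y (z + z') i j k = wedge3 x y z i j k + wedge3 x y z' i j k"
  by (simp_all add: wedge3_def algebra_simps)

lemma wedge3_scale:
  "wedge3 (c *s x) y z i j k = c * wedge3 x y z i j k"
  "wedge3 x (c *s y) z i j k = c * wedge3 x y z i j k"
  "wedge3 x y (c *s z) i j k = c * wedge3 x y z i j k"
  by (simp_all add: wedge3_def algebra_simps)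

lemma wedge3_repeated:
  "wedge3 x x z i j k = 0" "wedge3 x y x i j k = 0" "wedge3 x y y i j k = 0"
  by (simp_all add: wedge3_def algebra_simps)

lemma wedge3_swap: "wedge3 x z y i j k = - wedge3 x y z i j k"
  and wedge3_rotate: "wedge3 z x y i j k = wedge3 x y z i j k"
  by (simp_all add: wedge3_def algebra_simps)

lemma wedge3_0: "wedge3 x 0 z i j k = 0"
  by (simp add: wedge3_def)

lemmas wedge3_simps = wedge3_add wedge3_scale wedge3_repeated wedge3_0

text \<open>Unlike independence of the set \<open>{x, y}\<close>, this excludes \<open>x = y\<close>.\<close>
definition independent_pair :: "'a::field ^ 'n \<Rightarrow> 'a ^ 'n \<Rightarrow> bool"
  where "independent_pair x y \<longleftrightarrow> (\<forall>\<alpha> \<beta>. \<alpha> *s x + \<beta> *s y = 0 \<longrightarrow> \<alpha> = 0 \<and> \<beta> = 0)"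

lemma dependent_imp_multiple:
  fixes x y :: "'a::field ^ 'n"
  assumes "\<beta> \<noteq> 0" "\<alpha> *s x + \<beta> *s y = 0"
  shows "y = (- \<alpha> / \<beta>) *s x"
proof -
  have "y $ i = - \<alpha> / \<beta> * x $ i" for i
  proof -
    have "\<alpha> * x $ i + \<beta> * y $ i = 0"
      using assms(2) by (metis vector_add_component vector_smult_component zero_index)
    then have "\<beta> * y $ i = - \<alpha> * x $ i" by algebra
    then have "y $ i = (- \<alpha> * x $ i) / \<beta>"
      using assms(1) by (metis nonzero_mult_div_cancel_left)
    then show ?thesis by simp
  qed
  then show ?thesis by (simp add: vec_eq_iff)
qed

lemma independent_pairD:
  assumes "independent_pair x y" "\<alpha> *s x + \<beta> *s y = \<alpha>' *s x + \<beta>' *s y"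
  shows "\<alpha> = \<alpha>'" "\<beta> = \<beta>'"
proof -
  have "(\<alpha> - \<alpha>') *s x + (\<beta> - \<beta>') *s y = 0"
    using assms(2) by (simp add: vec_eq_iff algebra_simps)
  then have "\<alpha> - \<alpha>' = 0 \<and> \<beta> - \<beta>' = 0"
    using assms(1) unfolding independent_pair_def by blast
  then show "\<alpha> = \<alpha>'" "\<beta> = \<beta>'" by auto
qed

text \<open>
  Independence makes some \<open>2 \<times> 2\<close> minor of \<open>x\<close>, \<open>y\<close> nonzero, in rows \<open>p\<close>, \<open>q\<close> say. Expanding the
  vanishing minors in rows \<open>p\<close>, \<open>q\<close>, \<open>k\<close> along \<open>k\<close> solves for \<open>z\<close> by Cramer's rule.
\<close>
lemma wedge3_eq_0_imp_combination:
  assumes ind: "independent_pair x y" and zero: "\<And>i j k. wedge3 x y z i j k = 0"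
  obtains \<alpha> \<beta> where "z = \<alpha> *s x + \<beta> *s y"
proof -
  have "x \<noteq> 0"
  proof
    assume "x = 0"
    then have "1 *s x + 0 *s y = 0" by simp
    then show False using ind unfolding independent_pair_def by (metis zero_neq_one)
  qed
  then obtain p where p: "x $ p \<noteq> 0" by (auto simp: vec_eq_iff)
  have "\<exists>q. x $ p * y $ q - x $ q * y $ p \<noteq> 0"
  proof (rule ccontr)
    assume "\<not> ?thesis"
    then have "(- (y $ p)) *s x + (x $ p) *s y = 0"
      by (simp add: vec_eq_iff algebra_simps)
    then show False using ind p unfolding independent_pair_def by blast
  qed
  then obtain q where q: "x $ p * y $ q - x $ q * y $ p \<noteq> 0" by blast
  let ?d = "x $ p * y $ q - x $ q * y $ p"
  have "z $ k = (z $ p * y $ q - z $ q * y $ p) / ?d * x $ k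
      + (x $ p * z $ q - x $ q * z $ p) / ?d * y $ k" for k
  proof -
    have "?d * z $ k = (z $ p * y $ q - z $ q * y $ p) * x $ k
      + (x $ p * z $ q - x $ q * z $ p) * y $ k"
      using zero[of p q k] unfolding wedge3_def by algebra
    then have "z $ k = ((z $ p * y $ q - z $ q * y $ p) * x $ k
      + (x $ p * z $ q - x $ q * z $ p) * y $ k) / ?d"
      using q by (metis nonzero_mult_div_cancel_left)
    then show ?thesis by (simp only: add_divide_distrib times_divide_eq_left)
  qed
  then have "z = ((z $ p * y $ q - z $ q * y $ p) / ?d) *s x
      + ((x $ p * z $ q - x $ q * z $ p) / ?d) *s y"
    unfolding vec_eq_iff vector_add_component vector_smult_component by blast
  then show thesis by (rule that)
qed

lemma exists_wedge3_neq_0: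
  fixes x y :: "'a::field ^ 'n::finite"
  assumes card: "CARD('n) \<ge> 3" and ind: "independent_pair x y"
  obtains z i j k where "wedge3 x y z i j k \<noteq> 0"
proof -
  have "vec.dim (vec.span {x, y}) \<le> card {x, y}"
    using vec.dim_le_card[of "vec.span {x, y}" "{x, y}"] by simp
  also have "\<dots> \<le> 2" by (simp add: card_insert_if)
  finally have "vec.dim (vec.span {x, y}) \<noteq> vec.dim (UNIV :: ('a ^ 'n) set)"
    using card by (simp add: vec.dim_UNIV card_cart_basis)
  then have "vec.span {x, y} \<noteq> UNIV" by metis
  then obtain z where z: "z \<notin> vec.span {x, y}" by blast
  have "\<exists>i j k. wedge3 x y z i j k \<noteq> 0"
  proof (rule ccontr)
    assume "\<not> ?thesis"
    then obtain \<alpha> \<beta> where "z = \<alpha> *s x + \<beta> *s y"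
      using wedge3_eq_0_imp_combination[OF ind, of z] by blast
    then have "z \<in> vec.span {x, y}"
      by (auto intro!: vec.span_add vec.span_scale intro: vec.span_base)
    with z show False by blast
  qed
  then show thesis using that by blast
qed

section \<open>Pencils of operators whose local spans contain each vector\<close>

text \<open>
  The vanishing of \<open>a \<and> (P - I)a \<and> Qa\<close> at \<open>a\<^sub>0 \<plusminus> a\<close> confines \<open>P - I\<close> to the plane spanned by
  \<open>a\<^sub>0\<close> and \<open>Qa\<^sub>0\<close>. If \<open>P - I\<close> were nonzero, it would have rank one, and a further vector outside
  that plane could be found on which the hypothesis fails.
\<close>
lemma generic_fixed_vector_imp_identity:
  fixes P Q :: "'a::field ^ 'n::finite \<Rightarrow> 'a ^ 'n"
  assumes card: "CARD('n) \<ge> 3" and two: "(2::'a) \<noteq> 0"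
    and lin: "Vector_Spaces.linear (*s) (*s) P" "Vector_Spaces.linear (*s) (*s) Q"
    and loc: "\<And>a. \<exists>s t. a = s *s P a + t *s Q a"
    and fixed: "P a0 = a0" and ind: "independent_pair a0 (Q a0)"
  shows "P a = a"
proof -
  note [simp] = vec.linear_add[OF lin(1)] vec.linear_add[OF lin(2)]
    vec.linear_scale[OF lin(1)] vec.linear_scale[OF lin(2)]
  define b0 where "b0 = Q a0"
  define C where "C = (\<lambda>x. P x - x)"
  have ind: "independent_pair a0 b0" using ind by (simp add: b0_def)
  have C_add: "C (x + y) = C x + C y" and C_scale: "C (c *s x) = c *s C x" for x y c
    by (simp_all add: C_def vec_eq_iff algebra_simps)
  have C_a0: "C a0 = 0" by (simp add: C_def fixed)
  have P_eq: "P x = x + C x" for x by (simp add: C_def)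
  have dep: "wedge3 x (C x) (Q x) i j k = 0" for x i j k
  proof -
    obtain s t where st: "x = s *s P x + t *s Q x" using loc by blast
    have "wedge3 x (C x) (Q x) i j k = wedge3 x (P x) (Q x) i j k"
      by (simp add: P_eq wedge3_simps)
    also have "\<dots> = wedge3 (s *s P x + t *s Q x) (P x) (Q x) i j k"
      using st by simp
    also have "\<dots> = 0" by (simp only: wedge3_simps) simp
    finally show ?thesis .
  qed
  \<comment> \<open>The cubic dependency relation at \<open>a0 + x\<close> and \<open>a0 - x\<close>: half the sum and difference
    separate its homogeneous parts in \<open>x\<close>; the cubic part is the relation at \<open>x\<close> itself.\<close>
  have expand: "wedge3 a0 b0 (C x) i j k = 0 \<and>
      wedge3 a0 (C x) (Q x) i j k + wedge3 x (C x) b0 i j k = 0" for x i j k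
  proof -
    have 1: "wedge3 a0 (C x) b0 i j k + wedge3 a0 (C x) (Q x) i j k + wedge3 x (C x) b0 i j k = 0"
      using dep[of "a0 + x" i j k] dep[of x i j k]
      by (simp add: C_add C_a0 wedge3_simps b0_def algebra_simps)
    have 2: "wedge3 a0 (C x) b0 i j k - wedge3 a0 (C x) (Q x) i j k - wedge3 x (C x) b0 i j k = 0"
      using dep[of "a0 + (-1) *s x" i j k] dep[of x i j k]
      by (simp only: C_add C_scale C_a0 wedge3_simps b0_def
          vec.linear_add[OF lin(2)] vec.linear_scale[OF lin(2)])
        (simp add: algebra_simps wedge3_simps flip: b0_def)
    have "2 * wedge3 a0 (C x) b0 i j k = 0" using 1 2 by algebra
    then have "wedge3 a0 (C x) b0 i j k = 0" using two by simp
    with 1 show ?thesis by (simp add: wedge3_swap[of a0 b0 "C x"])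
  qed
  have "\<exists>\<alpha> \<beta>. C x = \<alpha> *s a0 + \<beta> *s b0" for x
    by (rule wedge3_eq_0_imp_combination[OF ind, of "C x"]) (use expand in auto)
  then have "\<forall>x. \<exists>\<alpha> \<beta>. C x = \<alpha> *s a0 + \<beta> *s b0" by (rule allI)
  then obtain f g where "\<forall>x. C x = f x *s a0 + g x *s b0"
    unfolding choice_iff by (elim exE)
  then have C_fg: "C x = f x *s a0 + g x *s b0" for x by (rule spec)
  have "f (x + y) *s a0 + g (x + y) *s b0 = (f x + f y) *s a0 + (g x + g y) *s b0" for x y
    using C_add[of x y] by (simp add: C_fg vec_eq_iff algebra_simps)
  note fg_add = independent_pairD[OF ind this]
  have "f (c *s x) *s a0 + g (c *s x) *s b0 = (c * f x) *s a0 + (c * g x) *s b0" for c x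
    using C_scale[of c x] by (simp add: C_fg vec_eq_iff algebra_simps)
  note fg_scale = independent_pairD[OF ind this]
  have "f a0 *s a0 + g a0 *s b0 = 0 *s a0 + 0 *s b0"
    using C_a0 by (simp add: C_fg)
  note fg_a0 = independent_pairD[OF ind this]
  \<comment> \<open>A linear map with kernel \<open>W = span(a0, b0)\<close>; it serves as the projection modulo \<open>W\<close>.\<close>
  define \<pi> where "\<pi> = wedge3 a0 b0"
  have pi_add: "\<pi> (x + y) i j k = \<pi> x i j k + \<pi> y i j k"
    and pi_scale: "\<pi> (c *s x) i j k = c * \<pi> x i j k" for x y c i j k
    by (simp_all add: \<pi>_def wedge3_simps)
  have pi_ab: "\<pi> a0 i j k = 0" "\<pi> b0 i j k = 0" for i j k
    by (simp_all add: \<pi>_def wedge3_simps)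
  have quad: "f x * \<pi> x i j k + g x * \<pi> (Q x) i j k = 0" for x i j k
    using expand[of x i j k] wedge3_rotate[of x a0 b0 i j k]
    by (simp add: C_fg wedge3_simps \<pi>_def algebra_simps)
  obtain z i0 j0 k0 where z: "\<pi> z i0 j0 k0 \<noteq> 0"
    using exists_wedge3_neq_0[OF card ind] unfolding \<pi>_def by blast
  have ker: "f x = 0" if gx: "g x = 0" for x
  proof (rule ccontr)
    assume fx: "f x \<noteq> 0"
    have Cx: "C x = f x *s a0" by (simp add: C_fg gx)
    have px: "\<pi> x i j k = 0" for i j k using quad[of x i j k] gx fx by simp
    have a0: "a0 \<noteq> 0"
      using z by (auto simp: \<pi>_def wedge3_def)
    have "independent_pair a0 x"
      unfolding independent_pair_def
    proof (intro allI impI)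
      fix \<alpha> \<beta> assume eq: "\<alpha> *s a0 + \<beta> *s x = 0"
      have "f (\<alpha> *s a0 + \<beta> *s x) = \<beta> * f x"
        by (simp only: fg_add fg_scale fg_a0) simp
      moreover have "f 0 = 0" using fg_scale(1)[of 0 0] by simp
      ultimately have "\<beta> = 0" using eq fx by simp
      then show "\<alpha> = 0 \<and> \<beta> = 0" using eq a0 by (auto simp: vec_eq_iff)
    qed
    moreover have "wedge3 a0 x (Q x) i j k = 0" for i j k
    proof -
      have "f x * wedge3 a0 x (Q x) i j k = - wedge3 x (C x) (Q x) i j k"
        by (simp add: Cx wedge3_scale) (simp add: wedge3_def algebra_simps)
      then show ?thesis using dep[of x i j k] fx by simp
    qed
    ultimately obtain \<alpha> \<beta> where Qx: "Q x = \<alpha> *s a0 + \<beta> *s x"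
      using wedge3_eq_0_imp_combination by metis
    have pQx: "\<pi> (Q x) i j k = 0" for i j k
      by (simp add: Qx pi_add pi_scale pi_ab px)
    \<comment> \<open>The polar form of \<open>quad\<close> at \<open>x\<close> and \<open>z\<close> has only this term left.\<close>
    have "f x * \<pi> z i0 j0 k0 = 0"
      using quad[of "x + z" i0 j0 k0] quad[of z i0 j0 k0]
      by (simp add: fg_add gx px pQx pi_add algebra_simps)
    then show False using fx z by simp
  qed
  have "g x = 0" for x
  proof (rule ccontr)
    assume gx: "g x \<noteq> 0"
    define \<kappa> where "\<kappa> = f x / g x"
    have f_eq: "f y = \<kappa> * g y" for y
    proof -
      have "g (y + (- (g y / g x)) *s x) = 0"
        using gx by (simp only: fg_add fg_scale) simp
      from ker[OF this] show ?thesis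
        using gx by (simp only: fg_add fg_scale) (simp add: \<kappa>_def field_simps)
    qed
    define w where "w = b0 + \<kappa> *s a0"
    define R where "R = (\<lambda>y. Q y + \<kappa> *s P y)"
    have Cw: "C y = g y *s w" for y
      by (simp add: C_fg f_eq w_def vec_eq_iff algebra_simps)
    have w0: "w \<noteq> 0"
    proof
      assume "w = 0"
      then have "\<kappa> *s a0 + 1 *s b0 = 0" by (simp add: w_def add.commute)
      then show False using ind unfolding independent_pair_def by (metis zero_neq_one)
    qed
    have pw: "\<pi> w i j k = 0" for i j k by (simp add: w_def pi_add pi_scale pi_ab)
    have R_add: "R (y + y') = R y + R y'" and R_scale: "R (c *s y) = c *s R y" for y y' c
      by (simp_all add: R_def vec_eq_iff algebra_simps)
    have gR: "g y * \<pi> (R y) i j k = 0" for y i j k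
    proof -
      have "\<pi> (R y) i j k = \<pi> (Q y) i j k + \<kappa> * \<pi> y i j k"
        by (simp add: R_def P_eq Cw pi_add pi_scale pw)
      then show ?thesis using quad[of y i j k] by (simp add: f_eq algebra_simps)
    qed
    \<comment> \<open>\<open>g\<close> can be cancelled from \<open>gR\<close> even at its zeros: there, add \<open>x\<close>, where \<open>g x \<noteq> 0\<close>.\<close>
    have pR: "\<pi> (R y) i j k = 0" for y i j k
    proof (cases "g y = 0")
      case True
      then show ?thesis
        using gR[of "y + x" i j k] gR[of x i j k] gx by (simp add: fg_add R_add pi_add)
    next
      case False
      then show ?thesis using gR[of y i j k] by simp
    qed
    have R_a0: "R a0 = w" by (simp add: R_def w_def b0_def fixed)
    have outside: "\<exists>t. g y *s w + t *s R y = 0" if y: "\<pi> y i0 j0 k0 \<noteq> 0" for y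
    proof -
      obtain s t where st: "y = s *s P y + t *s Q y" using loc by blast
      \<comment> \<open>\<open>s P + t Q = (s - t \<kappa>) P + t R\<close>, and modulo \<open>W\<close> this maps \<open>y\<close> to \<open>(s - t \<kappa>) y\<close>.\<close>
      let ?s = "s - t * \<kappa>"
      have y_eq: "y = ?s *s y + (?s * g y) *s w + t *s R y"
        by (subst st) (simp add: R_def P_eq Cw vec_eq_iff algebra_simps)
      have "\<pi> y i0 j0 k0 = ?s * \<pi> y i0 j0 k0"
        by (subst y_eq) (simp only: pi_add pi_scale pw pR, simp)
      then have "?s = 1" using y by simp
      then have "g y *s w + t *s R y = 0" using y_eq by simp
      then show ?thesis by blast
    qed
    have "\<exists>y. \<pi> y i0 j0 k0 \<noteq> 0 \<and> g y \<noteq> 0"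
    proof (cases "g z = 0 \<and> \<pi> x i0 j0 k0 = 0")
      case True
      then have "\<pi> (z + x) i0 j0 k0 \<noteq> 0 \<and> g (z + x) \<noteq> 0"
        using z gx by (simp add: pi_add fg_add)
      then show ?thesis by blast
    next
      case False
      then show ?thesis using z gx by blast
    qed
    then obtain y where y: "\<pi> y i0 j0 k0 \<noteq> 0" "g y \<noteq> 0" by blast
    obtain t where t: "g y *s w + t *s R y = 0" using outside[OF y(1)] by blast
    have "t \<noteq> 0" using t y(2) w0 by auto
    then have "R y = (- g y / t) *s w"
      using t by (rule dependent_imp_multiple)
    then have Ry: "R y = (- (g y / t)) *s w" by simp
    \<comment> \<open>Moving \<open>y\<close> along \<open>a0\<close> to the kernel of \<open>R\<close>, without changing \<open>g\<close> or leaving the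
      complement of \<open>W\<close>.\<close>
    define y' where "y' = y + (g y / t) *s a0"
    have "R y' = 0" unfolding y'_def by (simp only: R_add R_scale R_a0 Ry) simp
    moreover have "g y' = g y" by (simp add: y'_def fg_add fg_scale fg_a0)
    moreover have "\<pi> y' i0 j0 k0 \<noteq> 0" using y by (simp add: y'_def pi_add pi_scale pi_ab)
    ultimately show False using outside[of y'] y(2) w0 by simp
  qed
  then have "C a = 0" by (simp add: C_fg ker)
  then show ?thesis by (simp add: P_eq)
qed

text \<open>
  For \<open>a\<close> independent of \<open>a\<^sub>0\<close>, the sum \<open>a\<^sub>0 + a\<close> can be an eigenvector only if \<open>a\<^sub>0\<close> and \<open>a\<close>
  have the same eigenvalue.
\<close>
lemma eigenvectors_everywhere_imp_identity:
  fixes P :: "'a::field ^ 'n::finite \<Rightarrow> 'a ^ 'n"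
  assumes lin: "Vector_Spaces.linear (*s) (*s) P"
    and eig: "\<And>a. \<exists>c. P a = c *s a" and fixed: "P a0 = a0" "a0 \<noteq> 0"
  shows "P a = a"
proof (cases "independent_pair a0 a")
  case True
  obtain c d where c: "P a = c *s a" and d: "P (a0 + a) = d *s (a0 + a)" using eig by metis
  have "1 *s a0 + c *s a = d *s a0 + d *s a"
    using d by (simp add: vec.linear_add[OF lin] c fixed vec_eq_iff algebra_simps)
  from independent_pairD[OF True this] show ?thesis by (simp add: c)
next
  case False
  then obtain \<alpha> \<beta> where ab: "\<alpha> *s a0 + \<beta> *s a = 0" "\<not> (\<alpha> = 0 \<and> \<beta> = 0)"
    unfolding independent_pair_def by blast
  have "\<beta> \<noteq> 0" using ab fixed(2) by auto
  then have "a = (- \<alpha> / \<beta>) *s a0"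
    using ab(1) by (rule dependent_imp_multiple)
  then show ?thesis by (metis vec.linear_scale[OF lin] fixed(1))
qed

text \<open>
  As \<open>s \<noteq> 0\<close>, the operators \<open>sA + tB\<close> and \<open>B\<close> span the same pencil as \<open>A\<close> and \<open>B\<close>, and now the
  first of them fixes \<open>a\<^sub>0\<close>.
\<close>
lemma generic_pencil_member_eq_identity:
  fixes A B :: "'a::field ^ 'n::finite \<Rightarrow> 'a ^ 'n"
  assumes card: "CARD('n) \<ge> 3" and two: "(2::'a) \<noteq> 0"
    and lin: "Vector_Spaces.linear (*s) (*s) A" "Vector_Spaces.linear (*s) (*s) B"
    and loc: "\<And>a. \<exists>s t. a = s *s A a + t *s B a"
    and ind: "independent_pair (A a0) (B a0)"
    and st: "s *s A a0 + t *s B a0 = a0" and s: "s \<noteq> 0"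
  shows "s *s A a + t *s B a = a"
proof (rule generic_fixed_vector_imp_identity[where P = "\<lambda>a. s *s A a + t *s B a" and Q = B
      and ?a0.0 = a0, OF card two _ lin(2) _ st])
  show "Vector_Spaces.linear (*s) (*s) (\<lambda>a. s *s A a + t *s B a)"
    by (intro vec.linear_compose_add vec.linear_compose_scale_right lin)
next
  fix x
  obtain s' t' where "x = s' *s A x + t' *s B x" using loc by blast
  then have "x = (s' / s) *s (s *s A x + t *s B x) + (t' - s' / s * t) *s B x"
    using s by (simp add: vec_eq_iff field_simps)
  then show "\<exists>s' t'. x = s' *s (s *s A x + t *s B x) + t' *s B x" by blast
next
  show "independent_pair a0 (B a0)"
    unfolding independent_pair_def
  proof (intro allI impI)
    fix \<alpha> \<beta> assume "\<alpha> *s a0 + \<beta> *s B a0 = 0"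
    then have "(\<alpha> * s) *s A a0 + (\<alpha> * t + \<beta>) *s B a0 = 0"
      by (subst (asm) st[symmetric]) (simp add: vec_eq_iff algebra_simps)
    then have "\<alpha> * s = 0 \<and> \<alpha> * t + \<beta> = 0"
      using ind unfolding independent_pair_def by blast
    then show "\<alpha> = 0 \<and> \<beta> = 0" using s by auto
  qed
qed

text \<open>
  Either some vector has independent images, and the previous lemma applies with the operators
  in one order or the other, or else \<open>Aa\<close> and \<open>Ba\<close> always span at most a line; that line
  contains \<open>a\<close>, which makes every \<open>a\<close> an eigenvector of both operators.
\<close>
lemma identity_in_pencil:
  fixes A B :: "'a::field ^ 'n::finite \<Rightarrow> 'a ^ 'n"
  assumes card: "CARD('n) \<ge> 3" and two: "(2::'a) \<noteq> 0"
    and lin: "Vector_Spaces.linear (*s) (*s) A" "Vector_Spaces.linear (*s) (*s) B"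
    and loc: "\<And>a. \<exists>s t. a = s *s A a + t *s B a"
  obtains s t where "\<And>a. s *s A a + t *s B a = a"
proof -
  have lin_comb: "Vector_Spaces.linear (*s) (*s) (\<lambda>a. s *s A a + t *s B a)" for s t
    by (intro vec.linear_compose_add vec.linear_compose_scale_right lin)
  show thesis
  proof (cases "\<exists>a0. independent_pair (A a0) (B a0)")
    case True
    then obtain a0 where ind: "independent_pair (A a0) (B a0)" by blast
    obtain s t where st: "a0 = s *s A a0 + t *s B a0" using loc by blast
    have "s \<noteq> 0 \<or> t \<noteq> 0"
    proof (rule ccontr)
      assume "\<not> ?thesis"
      then have "a0 = 0" using st by simp
      then have "1 *s A a0 + 0 *s B a0 = 0"
        using vec.linear_scale[OF lin(1), of 0 0] by simp
      then show False using ind unfolding independent_pair_def by (metis zero_neq_one)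
    qed
    then have "s *s A a + t *s B a = a" for a
    proof
      assume "s \<noteq> 0"
      with generic_pencil_member_eq_identity[OF card two lin loc ind st[symmetric]]
      show ?thesis .
    next
      assume "t \<noteq> 0"
      have "\<exists>s t. x = s *s B x + t *s A x" for x
        using loc[of x] by (metis add.commute)
      moreover have "independent_pair (B a0) (A a0)"
        using ind unfolding independent_pair_def by (metis add.commute)
      moreover have "t *s B a0 + s *s A a0 = a0" using st by (simp add: add.commute)
      ultimately have "t *s B a + s *s A a = a"
        using generic_pencil_member_eq_identity[OF card two lin(2,1)] \<open>t \<noteq> 0\<close> by blast
      then show ?thesis by (simp add: add.commute)
    qed
    then show thesis by (rule that)
  next
    case False
    have eig: "(\<exists>c. A a = c *s a) \<and> (\<exists>c. B a = c *s a)" for a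
    proof -
      obtain \<alpha> \<beta> where ab: "\<alpha> *s A a + \<beta> *s B a = 0" "\<not> (\<alpha> = 0 \<and> \<beta> = 0)"
        using False unfolding independent_pair_def by blast
      obtain s t where st: "a = s *s A a + t *s B a" using loc by blast
      \<comment> \<open>The determinant of the two relations, solved for \<open>A a\<close> and \<open>B a\<close>.\<close>
      let ?d = "s * \<beta> - t * \<alpha>"
      have 1: "?d *s A a = \<beta> *s a" and 2: "?d *s B a = (- \<alpha>) *s a"
      proof -
        have e: "s * A a $ i + t * B a $ i = a $ i" "\<alpha> * A a $ i + \<beta> * B a $ i = 0" for i
          using st ab(1) by (metis vector_add_component vector_smult_component zero_index)+
        have "?d * A a $ i = \<beta> * (s * A a $ i + t * B a $ i) - t * (\<alpha> * A a $ i + \<beta> * B a $ i)"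
          "?d * B a $ i = s * (\<alpha> * A a $ i + \<beta> * B a $ i) - \<alpha> * (s * A a $ i + t * B a $ i)" for i
          by (simp_all add: algebra_simps)
        then have "?d * A a $ i = \<beta> * a $ i" "?d * B a $ i = (- \<alpha>) * a $ i" for i
          by (simp_all only: e) simp_all
        then show "?d *s A a = \<beta> *s a" "?d *s B a = (- \<alpha>) *s a"
          by (simp_all add: vec_eq_iff)
      qed
      show ?thesis
      proof (cases "?d = 0")
        case True
        then have "a = 0" using 1 2 ab(2) by auto
        then have "A a = 0" "B a = 0"
          using vec.linear_scale[OF lin(1), of 0 0]
            vec.linear_scale[OF lin(2), of 0 0] by simp_all
        then show ?thesis by (metis vec.scale_zero_left)
      next
        case False
        have "A a = (\<beta> / ?d) *s a" "B a = (- \<alpha> / ?d) *s a"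
          using 1 2 False by (simp_all add: vec_eq_iff field_simps)
        then show ?thesis by blast
      qed
    qed
    define a0 :: "'a ^ 'n" where "a0 = 1"
    have a0: "a0 \<noteq> 0" by (simp add: a0_def)
    obtain s t where st: "a0 = s *s A a0 + t *s B a0" using loc by blast
    have "s *s A a + t *s B a = a" for a
    proof (rule eigenvectors_everywhere_imp_identity[OF lin_comb])
      show "s *s A a0 + t *s B a0 = a0" "a0 \<noteq> 0" using st a0 by simp_all
      fix x
      obtain c d where "A x = c *s x" "B x = d *s x" using eig by blast
      then have "s *s A x + t *s B x = (s * c + t * d) *s x"
        by (simp add: vec_eq_iff algebra_simps)
      then show "\<exists>c. s *s A x + t *s B x = c *s x" by blast
    qed
    then show thesis by (rule that)
  qed
qed

section \<open>Evaluation of polynomials at a point\<close>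

definition monomial_value :: "'a::comm_semiring_1 ^ 'n \<Rightarrow> ('n::finite \<Rightarrow>\<^sub>0 nat) \<Rightarrow> 'a"
  where "monomial_value a m = (\<Prod>i\<in>UNIV. a $ i ^ Poly_Mapping.lookup m i)"

definition evaluate :: "'a::comm_semiring_1 ^ 'n \<Rightarrow> ('n::finite, 'a) mpoly \<Rightarrow> 'a"
  where "evaluate a p =
    (\<Sum>m\<in>Poly_Mapping.keys p. Poly_Mapping.lookup p m * monomial_value a m)"

lemma evaluate_superset:
  assumes "finite K" "Poly_Mapping.keys p \<subseteq> K"
  shows "evaluate a p = (\<Sum>m\<in>K. Poly_Mapping.lookup p m * monomial_value a m)"
  unfolding evaluate_def
  by (rule sum.mono_neutral_left) (use assms in \<open>auto simp: in_keys_iff\<close>)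

lemma evaluate_add: "evaluate a (p + q) = evaluate a p + evaluate a q"
proof -
  let ?K = "Poly_Mapping.keys p \<union> Poly_Mapping.keys q"
  have "evaluate a r = (\<Sum>m\<in>?K. Poly_Mapping.lookup r m * monomial_value a m)"
    if "r \<in> {p, q, p + q}" for r
    by (rule evaluate_superset) (use that keys_add[of p q] in auto)
  then show ?thesis by (simp add: lookup_add distrib_right sum.distrib)
qed

lemma evaluate_0: "evaluate a 0 = 0"
  by (simp add: evaluate_def)

lemma evaluate_single: "evaluate a (Poly_Mapping.single m c) = c * monomial_value a m"
  by (cases "c = 0") (simp_all add: evaluate_def)

lemma monomial_value_add:
  "monomial_value a (m + m') = monomial_value a m * monomial_value a m'"
  by (simp add: monomial_value_def lookup_add power_add prod.distrib)

lemma poly_mapping_sum_induct [case_names zero single sum]: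
  assumes zero: "P 0"
    and single: "\<And>m c. P (Poly_Mapping.single m c)"
    and sum: "\<And>p q. P p \<Longrightarrow> P q \<Longrightarrow> P (p + q)"
  shows "P p"
proof (induction p rule: update_induct)
  case const
  show ?case by (rule zero)
next
  case (update p m c)
  have "Poly_Mapping.update m c p = p + Poly_Mapping.single m c"
    using update by (intro poly_mapping_eqI)
      (auto simp: lookup_update lookup_add lookup_single when_def in_keys_iff)
  then show ?case using update single sum by simp
qed

lemma evaluate_mult: "evaluate a (p * q) = evaluate a p * evaluate a q"
proof (induction p rule: poly_mapping_sum_induct)
  case zero
  show ?case by (simp add: evaluate_0)
next
  case (single m c)
  show ?case
  proof (induction q rule: poly_mapping_sum_induct)
    case zero
    show ?case by (simp add: evaluate_0)
  next
    case (single m' c')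
    show ?case
      by (simp add: mult_single evaluate_single monomial_value_add mult_ac)
  next
    case (sum p q)
    then show ?case by (simp add: distrib_left evaluate_add)
  qed
next
  case (sum p q)
  then show ?case by (simp add: distrib_right evaluate_add)
qed

lemma evaluate_mconst: "evaluate a (mconst c) = c"
  by (simp add: mconst_def evaluate_single monomial_value_def)

lemma mconst_0: "mconst 0 = 0"
  by (simp add: mconst_def)

lemma evaluate_1: "evaluate a 1 = 1"
  by (metis evaluate_mconst mconst_1)

lemma evaluate_mvar: "evaluate a (mvar i) = a $ i"
proof -
  have "monomial_value a (Poly_Mapping.single i 1)
      = (\<Prod>j\<in>UNIV. if j = i then a $ j else 1)"
    unfolding monomial_value_def by (rule prod.cong) (auto simp: lookup_single when_def)
  then show ?thesis by (simp add: mvar_def evaluate_single)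
qed

lemma evaluate_diff:
  fixes p q :: "('n::finite, 'a::comm_ring_1) mpoly"
  shows "evaluate a (p - q) = evaluate a p - evaluate a q"
  using evaluate_add[of a "p - q" q] by simp

lemma evaluate_sum: "evaluate a (\<Sum>i\<in>I. f i) = (\<Sum>i\<in>I. evaluate a (f i))"
  by (induction I rule: infinite_finite_induct) (simp_all add: evaluate_0 evaluate_add)

lemma is_ideal_iff:
  "is_ideal I \<longleftrightarrow> 0 \<in> I \<and> (\<forall>x\<in>I. \<forall>y\<in>I. x + y \<in> I) \<and> (\<forall>c. \<forall>x\<in>I. c * x \<in> I)"
proof -
  have "module ((*) :: 'a::comm_ring_1 \<Rightarrow> _)"
    by unfold_locales (simp_all add: algebra_simps)
  then show ?thesis unfolding is_ideal_def by (simp add: module.subspace_def)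
qed

lemma maximal_ideal_of_point:
  fixes a :: "'a::field ^ 'n::finite"
  shows "maximal_ideal {p :: ('n, 'a) mpoly. evaluate a p = 0}"
  unfolding maximal_ideal_def
proof (intro conjI allI impI)
  let ?I = "{p :: ('n, 'a) mpoly. evaluate a p = 0}"
  show "is_ideal ?I"
    by (simp add: is_ideal_iff evaluate_0 evaluate_add evaluate_mult)
  have "1 \<notin> ?I" by (simp add: evaluate_1)
  then show "?I \<noteq> UNIV" by blast
  fix J assume "is_ideal J \<and> ?I \<subseteq> J"
  then have J: "is_ideal J" "?I \<subseteq> J" by auto
  show "J = ?I \<or> J = UNIV"
  proof (cases "J \<subseteq> ?I")
    case True
    with J show ?thesis by blast
  next
    case False
    then obtain p where p: "p \<in> J" "evaluate a p \<noteq> 0" by blast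
    let ?c = "evaluate a p"
    have "q \<in> J" for q
    proof -
      \<comment> \<open>Dividing \<open>p\<close> by its value at \<open>a\<close> gives an element of \<open>J\<close> that is \<open>1\<close> at \<open>a\<close>.\<close>
      have "q - mconst (1 / ?c) * q * p \<in> ?I"
        using p(2) by (simp add: evaluate_diff evaluate_mult evaluate_mconst)
      then have "q - mconst (1 / ?c) * q * p \<in> J" using J(2) by blast
      moreover have "mconst (1 / ?c) * q * p \<in> J" using J(1) p(1) by (simp add: is_ideal_iff)
      ultimately have "(q - mconst (1 / ?c) * q * p) + mconst (1 / ?c) * q * p \<in> J"
        using J(1) unfolding is_ideal_iff by blast
      then show ?thesis by simp
    qed
    then show ?thesis by blast
  qed
qed

text \<open>The coefficients of a linear form are its values at the standard basis vectors.\<close>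
lemma linear_form_expansion:
  fixes p :: "('n::finite, 'a::field) mpoly"
  assumes "p \<in> linear_forms"
  shows "p = (\<Sum>j\<in>UNIV. mconst (evaluate (axis j 1) p) * mvar j)"
  using assms unfolding linear_forms_def
proof (induction rule: F_poly.span_induct_alt)
  case base
  show ?case by (simp add: evaluate_0 mconst_def)
next
  case (step c x q)
  then obtain i where x: "x = mvar i" by blast
  have "mconst (evaluate (axis j 1) (mconst c * x + q)) * mvar j
      = (if j = i then mconst c * mvar i else 0) + mconst (evaluate (axis j 1) q) * mvar j" for j
    by (auto simp: x evaluate_add evaluate_mult evaluate_mconst evaluate_mvar axis_def
        mconst_add mconst_0 distrib_right)
  then have "(\<Sum>j\<in>UNIV. mconst (evaluate (axis j 1) (mconst c * x + q)) * mvar j)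
      = mconst c * x + (\<Sum>j\<in>UNIV. mconst (evaluate (axis j 1) q) * mvar j)"
    by (simp add: sum.distrib x)
  then show ?case using step by simp
qed

lemma linear_form_eqI:
  fixes p q :: "('n::finite, 'a::field) mpoly"
  assumes "p \<in> linear_forms" "q \<in> linear_forms" "\<And>a. evaluate a p = evaluate a q"
  shows "p = q"
  using linear_form_expansion[OF assms(1)] linear_form_expansion[OF assms(2)] assms(3) by simp

definition evaluate_vec :: "'a::comm_semiring_1 ^ 'n \<Rightarrow> ('n::finite, 'a) mpoly ^ 'm \<Rightarrow> 'a ^ 'm"
  where "evaluate_vec a v = (\<chi> i. evaluate a (v $ i))"

lemma evaluate_vec_simps:
  "evaluate_vec a 0 = 0"
  "evaluate_vec a (u + v) = evaluate_vec a u + evaluate_vec a v"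
  "evaluate_vec a (p *s v) = evaluate a p *s evaluate_vec a v"
  by (simp_all add: evaluate_vec_def vec_eq_iff evaluate_0 evaluate_add evaluate_mult)

lemma evaluate_vec_yvec: "evaluate_vec a yvec = a"
  by (simp add: evaluate_vec_def yvec_def evaluate_mvar vec_eq_iff)

lemma linear_evaluate_vec:
  fixes v :: "('n::finite, 'a::field) mpoly ^ 'm::finite"
  assumes "\<And>i. v $ i \<in> linear_forms"
  shows "Vector_Spaces.linear (*s) (*s) (\<lambda>a. evaluate_vec a v)"
proof -
  define c where "c i j = evaluate (axis j 1) (v $ i)" for i j
  have eval: "evaluate a (v $ i) = (\<Sum>j\<in>UNIV. c i j * a $ j)" for a i
    unfolding c_def
    by (subst linear_form_expansion[OF assms])
      (simp add: evaluate_sum evaluate_mult evaluate_mconst evaluate_mvar)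
  have "(\<lambda>a. evaluate_vec a v) = (*v) (\<chi> i j. c i j)"
    by (simp add: fun_eq_iff evaluate_vec_def matrix_vector_mult_def eval)
  then show ?thesis by simp
qed

section \<open>Local membership\<close>

text \<open>Congruence modulo the ideal of all polynomials vanishing at \<open>a\<close> is equality of values at \<open>a\<close>.\<close>
lemma local_membership_at_point:
  fixes V :: "(('n::finite, 'a::field) mpoly ^ 'n) set"
  assumes "y_local_membership V"
  obtains u where "u \<in> generated_submodule V" "evaluate_vec a u = a"
proof -
  let ?I = "{p :: ('n, 'a) mpoly. evaluate a p = 0}"
  obtain u where u: "u \<in> generated_submodule V" "reduce_mod ?I yvec = reduce_mod ?I u"
    using assms maximal_ideal_of_point[of a] unfolding y_local_membership_def by blast
  have "evaluate a (u $ i) = a $ i" for i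
  proof -
    have "yvec $ i +o ?I = u $ i +o ?I"
      using u(2) by (simp add: reduce_mod_def vec_eq_iff)
    moreover have "u $ i \<in> u $ i +o ?I"
      using evaluate_0 by (force simp: elt_set_plus_def)
    ultimately have "u $ i \<in> yvec $ i +o ?I" by simp
    then obtain p where "evaluate a p = 0" "u $ i = yvec $ i + p"
      unfolding elt_set_plus_def by blast
    then show ?thesis by (simp add: evaluate_add yvec_def evaluate_mvar)
  qed
  then have "evaluate_vec a u = a" by (simp add: evaluate_vec_def vec_eq_iff)
  with u(1) show thesis by (rule that)
qed

text \<open>
  A combination with polynomial coefficients becomes one with scalar coefficients at each point;
  the scalars depend on the point.
\<close>
lemma evaluate_vec_generated_submodule:
  fixes V :: "(('n::finite, 'a::field) mpoly ^ 'm::finite) set"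
  assumes "u \<in> generated_submodule (F_vec.span {v, w})"
  shows "\<exists>s t. evaluate_vec a u = s *s evaluate_vec a v + t *s evaluate_vec a w"
  using assms unfolding generated_submodule_def
proof (induction rule: R_vec.span_induct_alt)
  case base
  have "evaluate_vec a 0 = 0 *s evaluate_vec a v + 0 *s evaluate_vec a w"
    by (simp add: evaluate_vec_simps)
  then show ?case by blast
next
  case (step c x y)
  obtain s t where x: "x = mconst s *s v + mconst t *s w"
    using step(1) by (auto simp: F_vec.span_insert F_vec.span_singleton algebra_simps)
  obtain s' t' where y: "evaluate_vec a y = s' *s evaluate_vec a v + t' *s evaluate_vec a w"
    using step by blast
  have "evaluate_vec a (c *s x + y) = (evaluate a c * s + s') *s evaluate_vec a v
      + (evaluate a c * t + t') *s evaluate_vec a w"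
    by (simp add: evaluate_vec_simps x y evaluate_mconst) (simp add: vec_eq_iff algebra_simps)
  then show ?case by blast
qed

theorem theorem7:
  fixes V :: "(('n::{finite,linorder}, 'a::alg_closed_field) mpoly ^ 'n::{finite,linorder}) set"
  assumes "CARD('n) \<ge> 3"
    and "CHAR('a) > CARD('n) \<or> CHAR('a) = 0"
    and "F_vec.subspace V"
    and "V \<subseteq> {v. \<forall>i. v $ i \<in> linear_forms}"
    and "F_vec.dim V = 2"
    and "free_of_rank (generated_submodule V) 2"
    and "y_local_membership V"
  shows "yvec \<in> V"
proof -
  obtain B where B: "B \<subseteq> V" "F_vec.independent B" "V \<subseteq> F_vec.span B" "card B = F_vec.dim V"
    using F_vec.basis_exists by blast
  then obtain v w where vw: "B = {v, w}" using assms(5) by (auto simp: card_2_iff)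
  have V: "V = F_vec.span {v, w}"
    using B(1,3) assms(3) F_vec.span_minimal vw by blast
  have forms: "v $ i \<in> linear_forms" "w $ i \<in> linear_forms" for i
    using B(1) vw assms(4) by auto
  have two: "(2::'a) \<noteq> 0"
  proof
    assume "(2::'a) = 0"
    then have "CHAR('a) dvd 2" using of_nat_eq_0_iff_char_dvd[of 2, where ?'a = 'a] by simp
    then show False using assms(1,2) by (auto dest: dvd_imp_le)
  qed
  have loc: "\<exists>s t. a = s *s evaluate_vec a v + t *s evaluate_vec a w" for a
    using local_membership_at_point[OF assms(7), of a] evaluate_vec_generated_submodule V
    by metis
  obtain s t where st: "\<And>a. s *s evaluate_vec a v + t *s evaluate_vec a w = a"
    using identity_in_pencil[OF assms(1) two
        linear_evaluate_vec[of v] linear_evaluate_vec[of w]] forms loc by blast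
  let ?u = "mconst s *s v + mconst t *s w"
  have uV: "?u \<in> V"
    unfolding V by (intro F_vec.span_add F_vec.span_scale F_vec.span_base) simp_all
  have "yvec $ i = ?u $ i" for i
  proof (rule linear_form_eqI)
    show "yvec $ i \<in> linear_forms"
      by (simp add: yvec_def linear_forms_def F_poly.span_base)
    show "?u $ i \<in> linear_forms" using uV assms(4) by blast
    fix a
    have "evaluate_vec a ?u = a"
      using st[of a] by (simp add: evaluate_vec_simps evaluate_mconst)
    then have "evaluate_vec a yvec $ i = evaluate_vec a ?u $ i"
      by (simp add: evaluate_vec_yvec)
    then show "evaluate a (yvec $ i) = evaluate a (?u $ i)"
      by (simp add: evaluate_vec_def)
  qed
  then have "yvec = ?u" by (simp add: vec_eq_iff)
  with uV show ?thesis by simp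
qed

end
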